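(* Let $\mathcal L$ be a finite distributive strong upper semilattice, $\mathcal M$ its set of meet-irreducibles, $\mathcal D=\mathcal D(\mathcal M)$ the distributive lattice of order filters of $\mathcal M$ under reverse inclusion, $\nu\colon\mathcal L\to\mathcal D$, $\nu(x)=\{m\in\mathcal M: x\le m\}$, and let $V(\nu)\colon V(\mathcal L)\to V(\mathcal D)$ be the induced homomorphism of valuation rings (the one determined by $\iota_{\mathcal L}(x)\mapsto\iota_{\mathcal D}(\nu(x))$). For a nonempty set $X\subseteq\mathcal L$ let $X_{(m)}$ be the set of minimal elements of $X$, and define the element $$\bigwedge X=\sum_{\emptyset\neq B\subseteq X_{(m)}}(-1)^{|B|+1}\,\iota_{\mathcal L}\Big(\bigvee B\Big)\in V(\mathcal L).$$ Let $E=\{\bigwedge X : \emptyset\ne X\subseteq\mathcal L\}\subseteq V(\mathcal L)$ (the envelope), and let $F_X=\{m\in\mathcal M : m\ge x\text{ for some }x\in X\}\in\mathcal D$. Then $V(\nu)(\bigwedge X)=\iota_{\mathcal D}(F_X)$ for every nonempty $X\subseteq\mathcal L$, and $V(\nu)$ restricts to a bijection from $E$ onto $\iota_{\mathcal D}(\mathcal D)$. Consequently $E$, with join $e\vee f=ef$ (the ring product) and meet $e\wedge f=e+f-ef$, is a distributive lattice isomorphic to $\mathcal D$.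
   Context: A strong upper semilattice is an upper semilattice with a greatest element $\mathbf 1$, in which any two elements having a common lower bound have a greatest lower bound, denoted $x\wedge y$. It is distributive if every interval $[a,b]$ is a distributive lattice. An element $m\in\mathcal L$ is meet-irreducible if whenever $m=p\wedge q$ (with $p\wedge q$ existing) then $m=p$ or $m=q$; by this convention $\mathbf 1$ is meet-irreducible. $\mathcal D(\mathcal M)$ is the set of nonempty order filters (nonempty upward-closed subsets) of $\mathcal M$ ordered by reverse inclusion, so meet is union, join is intersection, $\{\mathbf 1\}$ is the greatest element and $\mathcal M$ the least. Valuation ring: for a distributive strong upper semilattice $\mathcal K$, let $\mathbb Z^{\mathcal K}$ be the free abelian group on the set $\mathcal K$, with the (commutative, not necessarily unital) ring multiplication obtained by extending $(x,y)\mapsto x\vee y$ bilinearly. Let $M(\mathcal K)$ be the subgroup generated by all elements $(a\vee b\vee c)+\big((a\vee c)\wedge(b\vee c)\big)-(a\vee c)-(b\vee c)$ with $a,b,c\in\mathcal K$; it is an ideal. Then $V(\mathcal K)=\mathbb Z^{\mathcal K}/M(\mathcal K)$, and $\iota_{\mathcal K}\colon\mathcal K\to V(\mathcal K)$ sends $x$ to its class. A map $f\colon\mathcal K_1\to\mathcal K_2$ preserving $\vee$, $\mathbf 1$ and all existing binary meets induces a ring homomorphism $V(f)\colon V(\mathcal K_1)\to V(\mathcal K_2)$ with $V(f)\circ\iota_{\mathcal K_1}=\iota_{\mathcal K_2}\circ f$; the map $\nu$ is of this type. *)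

theory Defs
  imports "HOL-Library.Poly_Mapping" "HOL-Computational_Algebra.Group_Closure"
begin

section \<open>Strong upper semilattices\<close>

context order
begin

definition is_meet :: "'a \<Rightarrow> 'a \<Rightarrow> 'a \<Rightarrow> bool"
  where "is_meet x y g \<longleftrightarrow> g \<le> x \<and> g \<le> y \<and> (\<forall>l. l \<le> x \<and> l \<le> y \<longrightarrow> l \<le> g)"

text \<open>Only meaningful if \<open>x\<close> and \<open>y\<close> have a greatest lower bound.\<close>

definition meet :: "'a \<Rightarrow> 'a \<Rightarrow> 'a"
  where "meet x y = (THE g. is_meet x y g)"

end

definition distrib_lattice_on :: "'a set \<Rightarrow> ('a \<Rightarrow> 'a \<Rightarrow> 'a) \<Rightarrow> ('a \<Rightarrow> 'a \<Rightarrow> 'a) \<Rightarrow> bool"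
  where "distrib_lattice_on A jn mt \<longleftrightarrow>
    (\<forall>x\<in>A. \<forall>y\<in>A. jn x y \<in> A \<and> mt x y \<in> A) \<and>
    (\<forall>x\<in>A. \<forall>y\<in>A. jn x y = jn y x \<and> mt x y = mt y x) \<and>
    (\<forall>x\<in>A. \<forall>y\<in>A. \<forall>z\<in>A. jn (jn x y) z = jn x (jn y z) \<and> mt (mt x y) z = mt x (mt y z)) \<and>
    (\<forall>x\<in>A. \<forall>y\<in>A. jn x (mt x y) = x \<and> mt x (jn x y) = x) \<and>
    (\<forall>x\<in>A. \<forall>y\<in>A. \<forall>z\<in>A. mt x (jn y z) = jn (mt x y) (mt x z))"

definition lattice_isomorphic_on ::
    "'a set \<Rightarrow> ('a \<Rightarrow> 'a \<Rightarrow> 'a) \<Rightarrow> ('a \<Rightarrow> 'a \<Rightarrow> 'a) \<Rightarrow>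
     'b set \<Rightarrow> ('b \<Rightarrow> 'b \<Rightarrow> 'b) \<Rightarrow> ('b \<Rightarrow> 'b \<Rightarrow> 'b) \<Rightarrow> bool"
  where "lattice_isomorphic_on A jA mA B jB mB \<longleftrightarrow>
    (\<exists>\<phi>. bij_betw \<phi> A B \<and>
      (\<forall>x\<in>A. \<forall>y\<in>A. \<phi> (jA x y) = jB (\<phi> x) (\<phi> y) \<and> \<phi> (mA x y) = mB (\<phi> x) (\<phi> y)))"

class strong_semilattice_sup = semilattice_sup + order_top +
  assumes ex_is_meet: "l \<le> x \<Longrightarrow> l \<le> y \<Longrightarrow> \<exists>g. is_meet x y g"

class distrib_strong_semilattice_sup = strong_semilattice_sup +
  assumes distrib_interval: "a \<le> b \<Longrightarrow> distrib_lattice_on {a..b} sup meet"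

lemma is_meet_unique: "is_meet x y g \<Longrightarrow> is_meet x y h \<Longrightarrow> g = h"
  by (meson is_meet_def order_antisym)

lemma meet_eq: "is_meet x y g \<Longrightarrow> meet x y = g"
  unfolding meet_def using is_meet_unique by blast

lemma is_meet_meet:
  fixes x y :: "'a::strong_semilattice_sup"
  assumes "l \<le> x" "l \<le> y"
  shows "is_meet x y (meet x y)"
  using ex_is_meet[OF assms] meet_eq by blast

lemma distrib_lattice_on_dual:
  assumes D: "distrib_lattice_on A jn mt" and "x \<in> A" "y \<in> A" "z \<in> A"
  shows "jn (mt x y) z = mt (jn x z) (jn y z)"
proof -
  have c: "jn u v \<in> A" "mt u v \<in> A" "jn u v = jn v u" "mt u v = mt v u"
      "jn u (mt u v) = u" "mt u (jn u v) = u" if "u \<in> A" "v \<in> A" for u v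
    using D that unfolding distrib_lattice_on_def by blast+
  have a: "jn (jn u v) w = jn u (jn v w)" "mt u (jn v w) = jn (mt u v) (mt u w)"
    if "u \<in> A" "v \<in> A" "w \<in> A" for u v w
    using D that unfolding distrib_lattice_on_def by blast+
  have "mt (jn x z) (jn y z) = jn (mt (jn x z) y) (mt (jn x z) z)"
    using a c assms by blast
  also have "mt (jn x z) z = z"
    using c assms by metis
  also have "mt (jn x z) y = jn (mt y x) (mt y z)"
    using a c assms by metis
  also have "jn (jn (mt y x) (mt y z)) z = jn (mt y x) (jn (mt y z) z)"
    using a c assms by metis
  also have "jn (mt y z) z = z"
    using c assms by metis
  finally show ?thesis using c assms by metis
qed

lemma meet_sup_distrib:
  fixes p q d :: "'a::distrib_strong_semilattice_sup"
  assumes "l \<le> p" "l \<le> q"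
  shows "sup (meet p q) d = meet (sup p d) (sup q d)"
proof -
  let ?g = "meet p q"
  have g: "?g \<le> p" "?g \<le> q"
    using is_meet_meet[OF assms] by (auto simp: is_meet_def)
  have "distrib_lattice_on {?g..top} sup meet"
    by (rule distrib_interval) simp
  from distrib_lattice_on_dual[OF this, of p q "sup ?g d"] g
  have "sup ?g (sup ?g d) = meet (sup p (sup ?g d)) (sup q (sup ?g d))" by simp
  moreover have "sup p (sup ?g d) = sup p d" "sup q (sup ?g d) = sup q d"
    using g by (metis sup.assoc sup.absorb1)+
  ultimately show ?thesis by (metis sup.assoc sup.idem)
qed

text \<open>The structure-preserving maps: joins, the greatest element and all existing binary meets.\<close>

definition strong_hom ::
    "('a::distrib_strong_semilattice_sup \<Rightarrow> 'b::distrib_strong_semilattice_sup) \<Rightarrow> bool"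
  where "strong_hom f \<longleftrightarrow> (\<forall>x y. f (sup x y) = sup (f x) (f y)) \<and> f top = top \<and>
    (\<forall>x y g. is_meet x y g \<longrightarrow> is_meet (f x) (f y) (f g))"

section \<open>Order filters of meet-irreducibles\<close>

definition meet_irreducible :: "'a::order \<Rightarrow> bool"
  where "meet_irreducible m \<longleftrightarrow> (\<forall>p q. is_meet p q m \<longrightarrow> m = p \<or> m = q)"

lemma meet_irreducible_top [simp]: "meet_irreducible (top::'a::order_top)"
  by (auto simp: meet_irreducible_def is_meet_def top_unique)

typedef (overloaded) ('a::distrib_strong_semilattice_sup) irr_filter =
  "{F :: 'a set. F \<noteq> {} \<and> F \<subseteq> {m. meet_irreducible m} \<and>
     (\<forall>m\<in>F. \<forall>n. meet_irreducible n \<and> m \<le> n \<longrightarrow> n \<in> F)}"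
  morphisms filter_set Abs_irr_filter
  by (rule exI[of _ "{top}"]) (auto simp: top_unique)

setup_lifting type_definition_irr_filter

lemma top_in_filter_set: "top \<in> filter_set F"
  using filter_set[of F] meet_irreducible_top top_greatest by fastforce

instantiation irr_filter :: (distrib_strong_semilattice_sup) distrib_lattice
begin

lift_definition less_eq_irr_filter :: "'a irr_filter \<Rightarrow> 'a irr_filter \<Rightarrow> bool"
  is "\<lambda>F G. G \<subseteq> F" .

lift_definition less_irr_filter :: "'a irr_filter \<Rightarrow> 'a irr_filter \<Rightarrow> bool"
  is "\<lambda>F G. G \<subset> F" .

lift_definition sup_irr_filter :: "'a irr_filter \<Rightarrow> 'a irr_filter \<Rightarrow> 'a irr_filter"
  is "\<lambda>F G. F \<inter> G"
proof -
  fix F G :: "'a set"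
  assume F: "F \<noteq> {} \<and> F \<subseteq> {m. meet_irreducible m} \<and>
      (\<forall>m\<in>F. \<forall>n. meet_irreducible n \<and> m \<le> n \<longrightarrow> n \<in> F)"
    and G: "G \<noteq> {} \<and> G \<subseteq> {m. meet_irreducible m} \<and>
      (\<forall>m\<in>G. \<forall>n. meet_irreducible n \<and> m \<le> n \<longrightarrow> n \<in> G)"
  then have "top \<in> F \<inter> G"
    using meet_irreducible_top top_greatest by blast
  with F G show "F \<inter> G \<noteq> {} \<and> F \<inter> G \<subseteq> {m. meet_irreducible m} \<and>
      (\<forall>m\<in>F \<inter> G. \<forall>n. meet_irreducible n \<and> m \<le> n \<longrightarrow> n \<in> F \<inter> G)"
    by blast
qed

lift_definition inf_irr_filter :: "'a irr_filter \<Rightarrow> 'a irr_filter \<Rightarrow> 'a irr_filter"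
  is "\<lambda>F G. F \<union> G"
  by blast

instance
  by standard (transfer; auto)+

end

instantiation irr_filter :: (distrib_strong_semilattice_sup) bounded_lattice
begin

lift_definition top_irr_filter :: "'a irr_filter" is "{top}"
  by (auto simp: top_unique)

lift_definition bot_irr_filter :: "'a irr_filter" is "{m. meet_irreducible m}"
  using meet_irreducible_top by blast

instance
proof
  fix F :: "'a irr_filter"
  show "bot \<le> F" by transfer auto
  show "F \<le> top" using top_in_filter_set[of F] by (simp add: less_eq_irr_filter.rep_eq top_irr_filter.rep_eq)
qed

end

lemma is_meet_inf: "is_meet x y (inf x y)" for x y :: "'a::lattice"
  by (simp add: is_meet_def)

lemma meet_eq_inf: "meet x y = inf x y" for x y :: "'a::lattice"
  by (rule meet_eq[OF is_meet_inf])

instance irr_filter :: (distrib_strong_semilattice_sup) distrib_strong_semilattice_sup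
proof
  fix l x y a b :: "'a irr_filter"
  show "\<exists>g. is_meet x y g" using is_meet_inf by blast
  show "distrib_lattice_on {a..b} sup meet"
    by (auto simp: distrib_lattice_on_def meet_eq_inf inf_sup_distrib1 ac_simps
        intro: le_supI1 le_infI1)
qed

section \<open>The valuation ring\<close>

definition free_mult :: "('a::semilattice_sup \<Rightarrow>\<^sub>0 int) \<Rightarrow> ('a \<Rightarrow>\<^sub>0 int) \<Rightarrow> ('a \<Rightarrow>\<^sub>0 int)"
  where "free_mult p q = frag_extend (\<lambda>x. frag_extend (\<lambda>y. frag_of (sup x y)) q) p"

definition val_relators :: "('a::distrib_strong_semilattice_sup \<Rightarrow>\<^sub>0 int) set"
  where "val_relators =
    {frag_of (sup (sup a b) c) + frag_of (meet (sup a c) (sup b c))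
       - frag_of (sup a c) - frag_of (sup b c) | a b c. True}"

abbreviation val_ideal :: "('a::distrib_strong_semilattice_sup \<Rightarrow>\<^sub>0 int) set"
  where "val_ideal \<equiv> group_closure val_relators"

lemma frag_induct [case_names zero one diff]:
  assumes "P 0" "\<And>x. P (frag_of x)" "\<And>p q. P p \<Longrightarrow> P q \<Longrightarrow> P (p - q)"
  shows "P p"
  using frag_induction[of p UNIV P] assms by auto

lemma free_mult_of_of [simp]: "free_mult (frag_of x) (frag_of y) = frag_of (sup x y)"
  by (simp add: free_mult_def)

lemma free_mult_0 [simp]: "free_mult 0 q = 0"
  by (simp add: free_mult_def)

lemma free_mult_diff_left: "free_mult (p - p') q = free_mult p q - free_mult p' q"
  by (simp add: free_mult_def frag_extend_diff)

lemma free_mult_diff_right: "free_mult p (q - q') = free_mult p q - free_mult p q'"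
  by (induction p rule: frag_induct) (simp_all add: free_mult_def frag_extend_diff)

lemma free_mult_add_left: "free_mult (p + p') q = free_mult p q + free_mult p' q"
  by (simp add: free_mult_def frag_extend_add)

lemma free_mult_0_right [simp]: "free_mult p 0 = 0"
  using free_mult_diff_right[of p 0 0] by simp

lemma free_mult_commute: "free_mult p q = free_mult q p"
proof (induction p rule: frag_induct)
  case (one x)
  show ?case
    by (induction q rule: frag_induct)
      (simp_all add: free_mult_diff_left free_mult_diff_right sup.commute)
qed (simp_all add: free_mult_diff_left free_mult_diff_right)

lemma free_mult_assoc: "free_mult (free_mult p q) r = free_mult p (free_mult q r)"
proof (induction p rule: frag_induct)
  case (one x)
  show ?case
  proof (induction q rule: frag_induct)
    case (one y)
    show ?case
      by (induction r rule: frag_induct)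
        (simp_all add: free_mult_diff_left free_mult_diff_right sup.assoc)
  qed (simp_all add: free_mult_diff_left free_mult_diff_right)
qed (simp_all add: free_mult_diff_left free_mult_diff_right)

lemma val_relator_mult_of:
  assumes "r \<in> val_relators"
  shows "free_mult r (frag_of d) \<in> val_relators"
proof -
  obtain a b c where r: "r = frag_of (sup (sup a b) c) + frag_of (meet (sup a c) (sup b c))
       - frag_of (sup a c) - frag_of (sup b c)"
    using assms by (auto simp: val_relators_def)
  have "sup (meet (sup a c) (sup b c)) d = meet (sup a (sup c d)) (sup b (sup c d))"
    by (subst meet_sup_distrib[of c]) (simp_all add: sup.assoc)
  then have "free_mult r (frag_of d) =
      frag_of (sup (sup a b) (sup c d)) + frag_of (meet (sup a (sup c d)) (sup b (sup c d)))
       - frag_of (sup a (sup c d)) - frag_of (sup b (sup c d))"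
    by (simp add: r free_mult_add_left free_mult_diff_left sup.assoc)
  then show ?thesis by (auto simp: val_relators_def)
qed

lemma val_ideal_mult:
  assumes "p \<in> val_ideal"
  shows "free_mult p q \<in> val_ideal"
  using assms
proof (induction p rule: group_closure.induct)
  case (base r)
  show ?case
  proof (induction q rule: frag_induct)
    case (one d)
    then show ?case
      using base val_relator_mult_of by (auto intro: group_closure.base)
  qed (simp_all add: free_mult_diff_right group_closure.diff)
next
  case (diff s t)
  then show ?case by (simp add: free_mult_diff_left group_closure.diff)
qed

lemma val_ideal_cmul: "p \<in> val_ideal \<Longrightarrow> frag_cmul k p \<in> val_ideal"
  by (rule frag_closure_minus_cmul[of "\<lambda>p. p \<in> val_ideal"]) (simp_all add: group_closure.diff)

definition val_eq :: "('a::distrib_strong_semilattice_sup \<Rightarrow>\<^sub>0 int) \<Rightarrow> ('a \<Rightarrow>\<^sub>0 int) \<Rightarrow> bool"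
  where "val_eq p q \<longleftrightarrow> p - q \<in> val_ideal"

lemma equivp_val_eq:
  "equivp (val_eq :: ('a::distrib_strong_semilattice_sup \<Rightarrow>\<^sub>0 int) \<Rightarrow> _)"
proof (rule equivpI)
  let ?R = "val_eq :: ('a \<Rightarrow>\<^sub>0 int) \<Rightarrow> _"
  show "reflp ?R" by (simp add: reflp_def val_eq_def)
  show "symp ?R"
    unfolding symp_def val_eq_def by (metis group_closure_minus_iff minus_diff_eq)
  show "transp ?R"
  proof (rule transpI)
    fix p q r :: "'a \<Rightarrow>\<^sub>0 int"
    assume "val_eq p q" "val_eq q r"
    then have "(p - q) + (q - r) \<in> val_ideal"
      unfolding val_eq_def by (rule group_closure_add)
    then show "val_eq p r" by (simp add: val_eq_def)
  qed
qed

quotient_type (overloaded) 'a valuation_ring =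
  "'a::distrib_strong_semilattice_sup \<Rightarrow>\<^sub>0 int" / val_eq
  morphisms rep_val abs_val
  by (rule equivp_val_eq)

instantiation valuation_ring :: (distrib_strong_semilattice_sup) comm_ring
begin

lift_definition zero_valuation_ring :: "'a valuation_ring" is 0 .

lift_definition plus_valuation_ring ::
    "'a valuation_ring \<Rightarrow> 'a valuation_ring \<Rightarrow> 'a valuation_ring" is "(+)"
  unfolding val_eq_def
proof -
  fix p p' q q' :: "'a \<Rightarrow>\<^sub>0 int"
  assume "p - p' \<in> val_ideal" "q - q' \<in> val_ideal"
  then have "(p - p') + (q - q') \<in> val_ideal" by (rule group_closure_add)
  then show "p + q - (p' + q') \<in> val_ideal" by (simp add: algebra_simps)
qed

lift_definition uminus_valuation_ring :: "'a valuation_ring \<Rightarrow> 'a valuation_ring" is uminus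
  unfolding val_eq_def
proof -
  fix p q :: "'a \<Rightarrow>\<^sub>0 int"
  assume "p - q \<in> val_ideal"
  then have "- (p - q) \<in> val_ideal" by (simp only: group_closure_minus_iff)
  then show "- p - - q \<in> val_ideal" by simp
qed

lift_definition minus_valuation_ring ::
    "'a valuation_ring \<Rightarrow> 'a valuation_ring \<Rightarrow> 'a valuation_ring" is "(-)"
  unfolding val_eq_def
proof -
  fix p p' q q' :: "'a \<Rightarrow>\<^sub>0 int"
  assume "p - p' \<in> val_ideal" "q - q' \<in> val_ideal"
  then have "(p - p') - (q - q') \<in> val_ideal" by (rule group_closure.diff)
  then show "p - q - (p' - q') \<in> val_ideal" by (simp add: algebra_simps)
qed

lift_definition times_valuation_ring ::
    "'a valuation_ring \<Rightarrow> 'a valuation_ring \<Rightarrow> 'a valuation_ring" is free_mult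
  unfolding val_eq_def
proof -
  fix p p' q q' :: "'a \<Rightarrow>\<^sub>0 int"
  assume "p - p' \<in> val_ideal" "q - q' \<in> val_ideal"
  then have "free_mult (p - p') q + free_mult (q - q') p' \<in> val_ideal"
    by (intro group_closure_add val_ideal_mult)
  also have "free_mult (p - p') q + free_mult (q - q') p' = free_mult p q - free_mult p' q'"
    by (simp add: free_mult_diff_left free_mult_commute[of q p'] free_mult_commute[of q' p'])
  finally show "free_mult p q - free_mult p' q' \<in> val_ideal" .
qed

instance
proof
  fix a b c :: "'a valuation_ring"
  show "a + b + c = a + (b + c)" by transfer (simp add: val_eq_def algebra_simps)
  show "a + b = b + a" by transfer (simp add: val_eq_def algebra_simps)
  show "0 + a = a" by transfer (simp add: val_eq_def)
  show "- a + a = 0" by transfer (simp add: val_eq_def)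
  show "a - b = a + - b" by transfer (simp add: val_eq_def)
  show "a * b * c = a * (b * c)" by transfer (simp add: val_eq_def free_mult_assoc)
  show "a * b = b * a" by transfer (simp add: val_eq_def free_mult_commute)
  show "(a + b) * c = a * c + b * c" by transfer (simp add: val_eq_def free_mult_add_left)
qed

end

text \<open>The valuation ring need not have a unit, so integer multiples are not products with
  \<^term>\<open>of_int\<close>.\<close>

lift_definition int_scale ::
    "int \<Rightarrow> 'a::distrib_strong_semilattice_sup valuation_ring \<Rightarrow> 'a valuation_ring" is frag_cmul
  unfolding val_eq_def
proof -
  fix k and p q :: "'a \<Rightarrow>\<^sub>0 int"
  assume "p - q \<in> val_ideal"
  then have "frag_cmul k (p - q) \<in> val_ideal" by (rule val_ideal_cmul)
  also have "frag_cmul k (p - q) = frag_cmul k p - frag_cmul k q"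
    by (rule poly_mapping_eqI) (simp add: lookup_minus algebra_simps)
  finally show "frag_cmul k p - frag_cmul k q \<in> val_ideal" .
qed

lift_definition val_of :: "'a::distrib_strong_semilattice_sup \<Rightarrow> 'a valuation_ring" is frag_of .

text \<open>The induced homomorphism is computed on a representative; for \<^term>\<open>strong_hom f\<close> the choice is
  irrelevant and the map is characterised by \<open>val_map_unique\<close> below.\<close>

definition val_map ::
    "('a::distrib_strong_semilattice_sup \<Rightarrow> 'b::distrib_strong_semilattice_sup) \<Rightarrow>
     'a valuation_ring \<Rightarrow> 'b valuation_ring"
  where "val_map f v = abs_val (frag_extend (frag_of \<circ> f) (rep_val v))"

lemma val_map_ideal:
  assumes f: "strong_hom f" and "p \<in> val_ideal"
  shows "frag_extend (frag_of \<circ> f) p \<in> val_ideal"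
  using assms(2)
proof (induction p rule: group_closure.induct)
  case (base r)
  show ?case
  proof (cases "r = 0")
    case False
    then obtain a b c where r: "r = frag_of (sup (sup a b) c) + frag_of (meet (sup a c) (sup b c))
         - frag_of (sup a c) - frag_of (sup b c)"
      using base by (auto simp: val_relators_def)
    have "is_meet (sup a c) (sup b c) (meet (sup a c) (sup b c))"
      by (rule is_meet_meet[of c]) simp_all
    then have "is_meet (f (sup a c)) (f (sup b c)) (f (meet (sup a c) (sup b c)))"
      using f unfolding strong_hom_def by blast
    then have "f (meet (sup a c) (sup b c)) = meet (sup (f a) (f c)) (sup (f b) (f c))"
      using f meet_eq by (metis strong_hom_def)
    then have "frag_extend (frag_of \<circ> f) r = frag_of (sup (sup (f a) (f b)) (f c))
        + frag_of (meet (sup (f a) (f c)) (sup (f b) (f c)))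
        - frag_of (sup (f a) (f c)) - frag_of (sup (f b) (f c))"
      using f by (simp add: r frag_extend_add frag_extend_diff strong_hom_def)
    then show ?thesis
      unfolding val_relators_def by (intro group_closure.base) blast
  qed simp
next
  case (diff s t)
  then show ?case by (simp add: frag_extend_diff group_closure.diff)
qed

lemma val_map_abs:
  assumes "strong_hom f"
  shows "val_map f (abs_val p) = abs_val (frag_extend (frag_of \<circ> f) p)"
proof -
  have "val_eq (rep_val (abs_val p)) p"
    by (rule Quotient3_rep_abs[OF Quotient3_valuation_ring]) (simp add: val_eq_def)
  then have "val_eq (frag_extend (frag_of \<circ> f) (rep_val (abs_val p))) (frag_extend (frag_of \<circ> f) p)"
    using val_map_ideal[OF assms] by (simp add: val_eq_def frag_extend_diff[symmetric])
  then show ?thesis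
    by (simp add: val_map_def valuation_ring.abs_eq_iff)
qed

definition rng_hom :: "('a::comm_ring \<Rightarrow> 'b::comm_ring) \<Rightarrow> bool"
  where "rng_hom h \<longleftrightarrow> (\<forall>u v. h (u + v) = h u + h v) \<and> (\<forall>u v. h (u * v) = h u * h v)"

lemma val_of_abs: "val_of x = abs_val (frag_of x)"
  by (simp add: val_of.abs_eq)

lemma rng_hom_val_map:
  assumes f: "strong_hom f"
  shows "rng_hom (val_map f)"
proof -
  have mult: "frag_extend (frag_of \<circ> f) (free_mult p q) =
      free_mult (frag_extend (frag_of \<circ> f) p) (frag_extend (frag_of \<circ> f) q)" for p q
  proof (induction p rule: frag_induct)
    case (one x)
    show ?case
      by (induction q rule: frag_induct)
        (use f in \<open>simp_all add: free_mult_diff_right frag_extend_diff strong_hom_def\<close>)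
  qed (simp_all add: free_mult_diff_left frag_extend_diff)
  have "val_map f (u + v) = val_map f u + val_map f v \<and>
        val_map f (u * v) = val_map f u * val_map f v" for u v
    by (induct u rule: valuation_ring.abs_induct, induct v rule: valuation_ring.abs_induct)
      (simp add: val_map_abs[OF f] plus_valuation_ring.abs_eq times_valuation_ring.abs_eq
        mult frag_extend_add)
  then show ?thesis by (simp add: rng_hom_def)
qed

lemma val_map_val_of:
  "strong_hom f \<Longrightarrow> val_map f (val_of x) = val_of (f x)"
  by (simp add: val_of_abs val_map_abs)

lemma val_map_unique:
  assumes f: "strong_hom f" and h: "rng_hom h" "\<And>x. h (val_of x) = val_of (f x)"
  shows "h = val_map f"
proof
  fix v
  have add: "h (u + w) = h u + h w" for u w using h by (simp add: rng_hom_def)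
  have hdiff: "h (u - w) = h u - h w" for u w
    using add[of "u - w" w] by simp
  have h0: "h 0 = 0" using hdiff[of 0 0] by simp
  have "h (abs_val p) = val_map f (abs_val p)" for p
  proof (induction p rule: frag_induct)
    case zero
    show ?case
      using h0 val_map_abs[OF f, of 0] by (simp add: zero_valuation_ring.abs_eq)
  next
    case (one x)
    then show ?case
      using h(2)[of x] val_map_val_of[OF f, of x] by (simp add: val_of_abs)
  next
    case (diff p q)
    then show ?case
      using hdiff[of "abs_val p" "abs_val q"]
      by (simp add: val_map_abs[OF f] minus_valuation_ring.abs_eq frag_extend_diff)
  qed
  then show "h v = val_map f v"
    by (induct v rule: valuation_ring.abs_induct) simp
qed

section \<open>The envelope\<close>

lift_definition nu :: "'a::{finite, distrib_strong_semilattice_sup} \<Rightarrow> 'a irr_filter"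
  is "\<lambda>x. {m. meet_irreducible m \<and> x \<le> m}"
proof -
  fix x :: 'a
  have "top \<in> {m. meet_irreducible m \<and> x \<le> m}" by simp
  then show "{m. meet_irreducible m \<and> x \<le> m} \<noteq> {} \<and>
      {m. meet_irreducible m \<and> x \<le> m} \<subseteq> {m. meet_irreducible m} \<and>
      (\<forall>m\<in>{m. meet_irreducible m \<and> x \<le> m}. \<forall>n. meet_irreducible n \<and> m \<le> n \<longrightarrow>
        n \<in> {m. meet_irreducible m \<and> x \<le> m})"
    by (blast intro: order_trans)
qed

lemma strong_hom_nu: "strong_hom nu"
  unfolding strong_hom_def
proof (intro conjI allI impI)
  fix x y :: 'a
  show "nu (sup x y) = sup (nu x) (nu y)" by transfer auto
  show "nu (top :: 'a) = top" by transfer (auto simp: top_unique)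
next
  fix x y g :: 'a
  assume g: "is_meet x y g"
  then have gle: "g \<le> x" "g \<le> y" and g_eq: "meet x y = g"
    using meet_eq by (auto simp: is_meet_def)
  have "x \<le> m \<or> y \<le> m" if m: "meet_irreducible m" "g \<le> m" for m
  proof -
    have "is_meet (sup x m) (sup y m) (meet (sup x m) (sup y m))"
      by (rule is_meet_meet[of m]) simp_all
    also have "meet (sup x m) (sup y m) = m"
      using meet_sup_distrib[OF gle, of m] g_eq m by (simp add: sup_absorb2)
    finally show ?thesis
      using m(1) unfolding meet_irreducible_def by (metis sup_ge1)
  qed
  then have "nu g = inf (nu x) (nu y)"
    using gle by transfer (auto intro: order_trans)
  then show "is_meet (nu x) (nu y) (nu g)" by (simp add: is_meet_inf)
qed

definition minimal_elements :: "'a::order set \<Rightarrow> 'a set"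
  where "minimal_elements X = {x \<in> X. \<forall>y\<in>X. y \<le> x \<longrightarrow> y = x}"

definition big_meet ::
    "'a::{finite, distrib_strong_semilattice_sup} set \<Rightarrow> 'a valuation_ring"
  where "big_meet X = (\<Sum>B\<in>{B. B \<noteq> {} \<and> B \<subseteq> minimal_elements X}.
    int_scale ((- 1) ^ (card B + 1)) (val_of (Sup_fin B)))"

definition envelope :: "'a::{finite, distrib_strong_semilattice_sup} valuation_ring set"
  where "envelope = {big_meet X | X. X \<noteq> {}}"

text \<open>Only meaningful for nonempty \<open>X\<close>; see \<open>filter_set_gen_filter\<close>.\<close>

definition gen_filter :: "'a::{finite, distrib_strong_semilattice_sup} set \<Rightarrow> 'a irr_filter"
  where "gen_filter X = Abs_irr_filter {m. meet_irreducible m \<and> (\<exists>x\<in>X. x \<le> m)}"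

lemma filter_set_gen_filter:
  assumes "X \<noteq> {}"
  shows "filter_set (gen_filter X) = {m. meet_irreducible m \<and> (\<exists>x\<in>X. x \<le> m)}"
  unfolding gen_filter_def
proof (rule Abs_irr_filter_inverse)
  have "top \<in> {m. meet_irreducible m \<and> (\<exists>x\<in>X. x \<le> m)}"
    using assms by auto
  then show "{m. meet_irreducible m \<and> (\<exists>x\<in>X. x \<le> m)} \<in> {F. F \<noteq> {} \<and> F \<subseteq> {m. meet_irreducible m} \<and>
     (\<forall>m\<in>F. \<forall>n. meet_irreducible n \<and> m \<le> n \<longrightarrow> n \<in> F)}"
    by (blast intro: order_trans)
qed

end

(* In the valuation ring put e \<and> f = e + f - ef (formally 1 - (1 - e)(1 - f)), so that big_meet X
   is the inclusion-exclusion expansion of the iterated meet of the minimal elements of X.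
   Elements of X above other elements of X are absorbed, and the defining relation turns an
   existing meet x = p \<and> q into val_of x = val_of p \<and> val_of q; hence val_of x is the iterated
   meet of the meet-irreducibles above x, and big_meet X depends only on the filter
   generated by X. This gives injectivity on the envelope, while val_of is injective on filters
   because membership of a fixed m is a {0,1}-valued valuation. *)
theory Submission
  imports Defs
begin

section \<open>Arithmetic of classes and of inclusion-exclusion sums\<close>

lemma val_of_mult: "val_of x * val_of y = val_of (sup x y)"
  by transfer (simp add: val_eq_def)

lemma int_scale_1 [simp]: "int_scale 1 v = v"
  by transfer (simp add: val_eq_def)

lemma int_scale_uminus: "int_scale (- k) v = - int_scale k v"
  by transfer (simp add: val_eq_def)

lemma int_scale_mult_right: "u * int_scale k v = int_scale k (u * v)"
proof transfer
  fix p q :: "'a \<Rightarrow>\<^sub>0 int" and k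
  have cmul: "frag_cmul k (r - s) = frag_cmul k r - frag_cmul k s" for r s :: "'a \<Rightarrow>\<^sub>0 int"
    by (rule poly_mapping_eqI) (simp add: lookup_minus algebra_simps)
  have "free_mult p (frag_cmul k q) = frag_cmul k (free_mult p q)"
  proof (induction p rule: frag_induct)
    case (one x)
    show ?case by (simp add: free_mult_def frag_extend_cmul)
  qed (simp_all add: free_mult_diff_left cmul)
  then show "val_eq (free_mult p (frag_cmul k q)) (frag_cmul k (free_mult p q))"
    by (simp add: val_eq_def)
qed

lemma val_of_meet:
  assumes "is_meet x y g"
  shows "val_of g = val_of x + val_of y - val_of x * val_of y"
proof -
  have g: "g \<le> x" "g \<le> y" "meet x y = g"
    using assms meet_eq by (auto simp: is_meet_def)
  then have "frag_of (sup x y) + frag_of g - frag_of x - frag_of y \<in> val_relators"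
    unfolding val_relators_def
    \<comment> \<open>The relator with \<open>c = g\<close> is the relation sought: joining with
      \<open>g\<close> leaves \<open>x\<close>, \<open>y\<close> and \<open>sup x y\<close>
      unchanged.\<close>
    by (intro CollectI exI[of _ x] exI[of _ y] exI[of _ g])
      (simp add: sup_absorb1 le_supI1)
  then have "val_eq (frag_of (sup x y) + frag_of g) (frag_of x + frag_of y)"
    by (simp add: val_eq_def group_closure.base diff_diff_eq)
  then have "val_of (sup x y) + val_of g = val_of x + val_of y"
    by (simp add: val_of_abs plus_valuation_ring.abs_eq valuation_ring.abs_eq_iff)
  then show ?thesis
    by (simp add: val_of_mult algebra_simps)
qed

text \<open>Formally \<open>1 - P\<close>, where \<open>P\<close> is the product of
  \<open>1 - val_of x\<close> over \<open>S\<close>, expanded because a unit may be missing. Using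
  all of \<open>S\<close> instead of its minimal elements, with value 0 at \<open>{}\<close>, makes
  induction on \<open>S\<close> possible.\<close>

definition incl_excl ::
    "'a::{finite, distrib_strong_semilattice_sup} set \<Rightarrow> 'a valuation_ring"
  where "incl_excl S = (\<Sum>B\<in>{B. B \<noteq> {} \<and> B \<subseteq> S}.
    int_scale ((- 1) ^ (card B + 1)) (val_of (Sup_fin B)))"

lemma incl_excl_empty [simp]: "incl_excl {} = 0"
  by (simp add: incl_excl_def)

text \<open>Three kinds of subsets give the three terms: \<open>{x}\<close>, those avoiding
  \<open>x\<close>, and those containing \<open>x\<close> and more. \<open>{x}\<close> stands apart
  since removing \<open>x\<close> from it leaves no join to take.\<close>

lemma incl_excl_insert_new:
  fixes x :: "'a::{finite, distrib_strong_semilattice_sup}"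
  assumes "x \<notin> S"
  shows "incl_excl (insert x S) = val_of x + incl_excl S - val_of x * incl_excl S"
proof -
  let ?P = "{B. B \<noteq> {} \<and> B \<subseteq> S}"
  let ?t = "\<lambda>B :: 'a set. int_scale ((- 1) ^ (card B + 1)) (val_of (Sup_fin B))"
  have split: "{B. B \<noteq> {} \<and> B \<subseteq> insert x S} = insert {x} (?P \<union> insert x ` ?P)"
    (is "?A = ?B")
  proof
    show "?A \<subseteq> ?B"
    proof
      fix B assume "B \<in> ?A"
      then have B: "B \<noteq> {}" "B \<subseteq> insert x S" by auto
      show "B \<in> ?B"
      proof (cases "x \<in> B")
        case True
        then obtain C where "B = insert x C" "x \<notin> C" by (rule Set.set_insert)
        with B assms show ?thesis by (cases "C = {}") auto
      qed (use B in auto)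
    qed
  qed auto
  have inj: "inj_on (insert x) ?P"
  proof (rule inj_onI)
    fix B C assume "B \<in> ?P" "C \<in> ?P" "insert x B = insert x C"
    moreover from this have "x \<notin> B" "x \<notin> C" using assms by auto
    ultimately show "B = C" by (simp add: insert_ident)
  qed
  \<comment> \<open>The extra element flips the sign, and joining with \<open>x\<close> becomes
    multiplication by \<open>val_of x\<close>.\<close>
  have new: "?t (insert x B) = - (val_of x * ?t B)" if "B \<in> ?P" for B
  proof -
    have "x \<notin> B" "B \<noteq> {}" using that assms by auto
    then show ?thesis
      by (simp add: Sup_fin.insert int_scale_uminus int_scale_mult_right val_of_mult)
  qed
  have "incl_excl (insert x S) = ?t {x} + (sum ?t ?P + sum ?t (insert x ` ?P))"
    unfolding incl_excl_def split
    using assms by (subst sum.insert) (auto intro!: sum.union_disjoint)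
  also have "sum ?t (insert x ` ?P) = - (val_of x * incl_excl S)"
    by (simp only: sum.reindex[OF inj] o_def incl_excl_def sum_distrib_left sum_negf[symmetric])
      (rule sum.cong[OF refl], rule new)
  finally show ?thesis by (simp add: incl_excl_def)
qed

text \<open>Once \<open>y\<close> is split off, \<open>val_of x * val_of y = val_of x\<close> makes
  the two terms containing the rest of the sum cancel.\<close>

lemma val_of_mult_incl_excl_absorb:
  assumes "y \<in> S" "y \<le> x"
  shows "val_of x * incl_excl S = val_of x"
proof -
  have xy: "val_of x * val_of y = val_of x"
    using assms(2) by (simp add: val_of_mult sup_absorb1)
  have "incl_excl S = val_of y + incl_excl (S - {y}) - val_of y * incl_excl (S - {y})"
    using incl_excl_insert_new[of y "S - {y}"] assms(1) by (simp add: insert_absorb)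
  then show ?thesis
    by (simp add: distrib_left right_diff_distrib mult.assoc[symmetric] xy)
qed

text \<open>If \<open>x\<close> is already in \<open>S\<close>, absorption with \<open>y = x\<close>
  cancels the two extra terms.\<close>

lemma incl_excl_insert:
  "incl_excl (insert x S) = val_of x + incl_excl S - val_of x * incl_excl S"
  by (cases "x \<in> S")
    (simp_all add: incl_excl_insert_new val_of_mult_incl_excl_absorb[of x] insert_absorb)

lemma incl_excl_singleton [simp]: "incl_excl {x} = val_of x"
  by (simp add: incl_excl_insert)

lemma incl_excl_insert_absorb:
  "y \<in> S \<Longrightarrow> y \<le> x \<Longrightarrow> incl_excl (insert x S) = incl_excl S"
  by (simp add: incl_excl_insert val_of_mult_incl_excl_absorb)

lemma incl_excl_Un:
  "incl_excl (S \<union> T) = incl_excl S + incl_excl T - incl_excl S * incl_excl T"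
  using finite[of S]
  by (induction S) (simp_all add: incl_excl_insert distrib_left distrib_right
      left_diff_distrib right_diff_distrib mult.assoc)

lemma incl_excl_idem: "incl_excl S * incl_excl S = incl_excl S"
  using incl_excl_Un[of S S] by simp

lemma incl_excl_absorb:
  assumes "\<And>x. x \<in> T \<Longrightarrow> \<exists>y\<in>S. y \<le> x"
  shows "incl_excl (S \<union> T) = incl_excl S"
  using finite[of T] assms
proof (induction T)
  case (insert x T)
  then obtain y where "y \<in> S" "y \<le> x" by auto
  with insert show ?case by (simp add: incl_excl_insert_absorb[of y])
qed simp

section \<open>Big meets and products as inclusion-exclusion sums\<close>

lemma ex_minimal_element_le:
  fixes x :: "'a::{finite, order}"
  assumes "x \<in> X"
  shows "\<exists>y\<in>minimal_elements X. y \<le> x"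
proof -
  obtain y where "y \<in> X" "y \<le> x" "\<forall>z\<in>X. z \<le> y \<longrightarrow> y = z"
    using finite_has_minimal2[of X x] assms by auto
  then show ?thesis by (auto simp: minimal_elements_def)
qed

text \<open>By finiteness every element of \<open>X\<close> lies above a minimal one, which absorbs
  it.\<close>

lemma big_meet_eq_incl_excl: "big_meet X = incl_excl X"
proof -
  have "incl_excl (minimal_elements X \<union> X) = incl_excl (minimal_elements X)"
    using ex_minimal_element_le by (rule incl_excl_absorb)
  moreover have "minimal_elements X \<union> X = X"
    by (auto simp: minimal_elements_def)
  ultimately show ?thesis
    by (simp add: big_meet_def incl_excl_def)
qed

lemma val_of_mult_incl_excl: "val_of x * incl_excl S = incl_excl (sup x ` S)"
  using finite[of S]
proof (induction S)
  case (insert y S)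
  have "val_of (sup x y) * (val_of x * incl_excl S) = val_of x * (val_of y * incl_excl S)"
    by (simp add: mult.assoc[symmetric] val_of_mult ac_simps)
  then show ?case
    by (simp add: incl_excl_insert insert.IH[symmetric] val_of_mult[symmetric]
        distrib_left right_diff_distrib)
qed simp

text \<open>Product distributes over the formal meet; this closes the envelope under
  products.\<close>

lemma incl_excl_mult: "incl_excl S * incl_excl T = incl_excl (\<Union>x\<in>S. sup x ` T)"
  using finite[of S]
proof (induction S)
  case (insert x S)
  \<comment> \<open>Expanding the union on the right-hand side produces \<open>incl_excl T\<close>
    twice; idempotence removes the duplicate.\<close>
  have "(val_of x * incl_excl T) * (incl_excl S * incl_excl T)
      = val_of x * incl_excl S * (incl_excl T * incl_excl T)"
    by (simp only: mult.assoc mult.commute mult.left_commute)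
  then show ?case
    by (simp add: incl_excl_Un incl_excl_insert insert.IH[symmetric]
        val_of_mult_incl_excl[symmetric] incl_excl_idem distrib_right left_diff_distrib)
qed simp

section \<open>Dependence on the generated filter only\<close>

lemma nu_meet: "is_meet p q x \<Longrightarrow> nu x = inf (nu p) (nu q)"
  using strong_hom_nu is_meet_unique[OF _ is_meet_inf] unfolding strong_hom_def by blast

text \<open>Induction on the number of elements strictly above \<open>x\<close>. An irreducible
  \<open>x\<close> belongs to its own filter and absorbs the rest; otherwise \<open>x\<close> is a
  meet of two strictly larger elements, and both sides turn this meet into
  \<open>e + f - e * f\<close>.\<close>

lemma val_of_eq_incl_excl_nu: "val_of x = incl_excl (filter_set (nu x))"
proof (induction "card {x<..}" arbitrary: x rule: less_induct)
  case less
  show ?case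
  proof (cases "meet_irreducible x")
    case True
    then have "x \<in> filter_set (nu x)" by (simp add: nu.rep_eq)
    moreover have "incl_excl ({x} \<union> filter_set (nu x)) = incl_excl {x}"
      by (rule incl_excl_absorb) (simp add: nu.rep_eq)
    ultimately show ?thesis by (simp add: insert_absorb)
  next
    case False
    then obtain p q where m: "is_meet p q x" and ne: "x \<noteq> p" "x \<noteq> q"
      by (auto simp: meet_irreducible_def)
    then have "x < p" "x < q"
      by (auto simp: is_meet_def)
    then have "card {p<..} < card {x<..}" "card {q<..} < card {x<..}"
      by (auto intro!: psubset_card_mono)
    then have "val_of p = incl_excl (filter_set (nu p))" "val_of q = incl_excl (filter_set (nu q))"
      using less by blast+
    then show ?thesis
      by (simp add: val_of_meet[OF m] nu_meet[OF m] inf_irr_filter.rep_eq incl_excl_Un)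
  qed
qed

lemma gen_filter_singleton: "gen_filter {x} = nu x"
  by (simp add: filter_set_inject[symmetric] filter_set_gen_filter nu.rep_eq)

lemma gen_filter_insert:
  "S \<noteq> {} \<Longrightarrow> gen_filter (insert x S) = inf (nu x) (gen_filter S)"
  by (auto simp: filter_set_inject[symmetric] filter_set_gen_filter nu.rep_eq
      inf_irr_filter.rep_eq)

lemma gen_filter_filter_set: "gen_filter (filter_set F) = F"
proof -
  have "filter_set F \<noteq> {}" using top_in_filter_set by blast
  then show ?thesis
    using filter_set[of F] by (auto simp: filter_set_inject[symmetric] filter_set_gen_filter)
qed

text \<open>Each generator may be replaced by the irreducibles above it, so the sum is recovered
  from the filter. Injectivity on the envelope rests on this.\<close>

lemma incl_excl_gen_filter:
  assumes "S \<noteq> {}"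
  shows "incl_excl (filter_set (gen_filter S)) = incl_excl S"
  using finite[of S] assms
proof (induction S rule: finite_ne_induct)
  case (singleton x)
  show ?case by (simp add: gen_filter_singleton val_of_eq_incl_excl_nu[symmetric])
next
  case (insert x S)
  then show ?case
    by (simp add: gen_filter_insert inf_irr_filter.rep_eq incl_excl_Un incl_excl_insert
        val_of_eq_incl_excl_nu[symmetric])
qed

section \<open>Passage to the valuation ring of filters\<close>

lemma val_of_inf: "val_of (inf x y) = val_of x + val_of y - val_of x * val_of y"
  for x y :: "'a::distrib_strong_semilattice_sup irr_filter"
  by (rule val_of_meet[OF is_meet_inf])

lemma rng_hom_diff: "rng_hom h \<Longrightarrow> h (u - v) = h u - h v"
  unfolding rng_hom_def by (metis add_diff_cancel_right' diff_add_cancel)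

text \<open>Both sides obey the same recursion under \<open>insert\<close>: meets of filters always
  exist, so \<open>val_of_inf\<close> applies to them.\<close>

lemma val_map_nu_incl_excl:
  assumes "S \<noteq> {}"
  shows "val_map nu (incl_excl S) = val_of (gen_filter S)"
  using finite[of S] assms
proof (induction S rule: finite_ne_induct)
  case (singleton x)
  show ?case by (simp add: gen_filter_singleton val_map_val_of strong_hom_nu)
next
  case (insert x S)
  have h: "rng_hom (val_map nu :: 'a valuation_ring \<Rightarrow> _)"
    by (rule rng_hom_val_map[OF strong_hom_nu])
  then have "val_map nu (u + v) = val_map nu u + val_map nu v"
    "val_map nu (u * v) = val_map nu u * val_map nu v" for u v :: "'a valuation_ring"
    by (simp_all add: rng_hom_def)
  with insert h show ?case
    by (simp add: incl_excl_insert gen_filter_insert rng_hom_diff val_of_inf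
        val_map_val_of strong_hom_nu)
qed

text \<open>For fixed \<open>m\<close>, the indicator of membership extends additively and kills the
  ideal, since joins and meets of filters are intersections and unions. These functionals separate
  filters.\<close>

lemma inj_val_of_irr_filter:
  "inj (val_of :: 'a::distrib_strong_semilattice_sup irr_filter \<Rightarrow> _)"
proof (rule injI)
  fix F G :: "'a irr_filter"
  assume "val_of F = val_of G"
  then have FG: "frag_of F - frag_of G \<in> val_ideal"
    by (simp add: val_of_abs valuation_ring.abs_eq_iff val_eq_def)
  have "m \<in> filter_set F \<longleftrightarrow> m \<in> filter_set G" for m
  proof -
    \<comment> \<open>The free abelian group on the one-point type serves as a copy of the integers,
      so that \<open>frag_extend\<close> supplies additivity.\<close>
    define \<chi> where "\<chi> = frag_extend (\<lambda>H. if m \<in> filter_set H then frag_of () else 0)"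
    have "\<chi> p = 0" if "p \<in> val_ideal" for p
      using that
    proof (induction p rule: group_closure.induct)
      case (base r)
      then show ?case
        by (auto simp: \<chi>_def val_relators_def frag_extend_add frag_extend_diff meet_eq_inf
            sup_irr_filter.rep_eq inf_irr_filter.rep_eq)
    next
      case (diff s t)
      then show ?case by (simp add: \<chi>_def frag_extend_diff)
    qed
    from this[OF FG] show ?thesis
      by (simp add: \<chi>_def frag_extend_diff split: if_splits)
  qed
  then show "F = G" by (auto simp: filter_set_inject[symmetric])
qed

section \<open>Bijection and lattice structure on the envelope\<close>

lemma envelope_eq: "envelope = {incl_excl X | X. X \<noteq> {}}"
  by (simp add: envelope_def big_meet_eq_incl_excl)

lemma bij_betw_val_map_nu:
  "bij_betw (val_map nu) (envelope :: 'a::{finite, distrib_strong_semilattice_sup} valuation_ring set)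
    (range val_of)"
  unfolding bij_betw_def
proof
  show "inj_on (val_map nu) (envelope :: 'a valuation_ring set)"
  proof (rule inj_onI)
    fix e f :: "'a valuation_ring"
    assume "e \<in> envelope" "f \<in> envelope" and eq: "val_map nu e = val_map nu f"
    then obtain X Y where X: "X \<noteq> {}" "e = incl_excl X" and Y: "Y \<noteq> {}" "f = incl_excl Y"
      by (auto simp: envelope_eq)
    with eq have "gen_filter X = gen_filter Y"
      by (auto simp: val_map_nu_incl_excl dest: injD[OF inj_val_of_irr_filter])
    with X Y show "e = f" by (metis incl_excl_gen_filter)
  qed
  show "val_map nu ` (envelope :: 'a valuation_ring set) = range val_of"
  proof
    show "val_map nu ` (envelope :: 'a valuation_ring set) \<subseteq> range val_of"
      unfolding envelope_eq by clarify (simp add: val_map_nu_incl_excl)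
    show "range val_of \<subseteq> val_map nu ` (envelope :: 'a valuation_ring set)"
    proof
      fix v assume "v \<in> range (val_of :: 'a irr_filter \<Rightarrow> _)"
      then obtain F :: "'a irr_filter" where F: "v = val_of F" by auto
      \<comment> \<open>A filter generates itself, so its own set of irreducibles yields a
        preimage.\<close>
      have "filter_set F \<noteq> {}" using top_in_filter_set by blast
      then have "v = val_map nu (incl_excl (filter_set F))" "incl_excl (filter_set F) \<in> envelope"
        by (auto simp: F val_map_nu_incl_excl gen_filter_filter_set envelope_eq)
      then show "v \<in> val_map nu ` envelope" by blast
    qed
  qed
qed

lemma envelope_idem: "e \<in> envelope \<Longrightarrow> e * e = e"
  by (auto simp: envelope_eq incl_excl_idem)

lemma envelope_mult: "e \<in> envelope \<Longrightarrow> f \<in> envelope \<Longrightarrow> e * f \<in> envelope"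
  unfolding envelope_eq by (clarsimp simp: incl_excl_mult) blast

lemma envelope_meet: "e \<in> envelope \<Longrightarrow> f \<in> envelope \<Longrightarrow> e + f - e * f \<in> envelope"
  unfolding envelope_eq by (clarsimp simp: incl_excl_Un[symmetric]) blast

text \<open>After expansion, each lattice law is a polynomial identity modulo
  \<open>e * e = e\<close>.\<close>

lemma distrib_lattice_on_idempotents:
  fixes A :: "'a::comm_ring set"
  assumes "\<And>e. e \<in> A \<Longrightarrow> e * e = e"
    and "\<And>e f. e \<in> A \<Longrightarrow> f \<in> A \<Longrightarrow> e * f \<in> A"
    and "\<And>e f. e \<in> A \<Longrightarrow> f \<in> A \<Longrightarrow> e + f - e * f \<in> A"
  shows "distrib_lattice_on A (\<lambda>e f. e * f) (\<lambda>e f. e + f - e * f)"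
proof -
  \<comment> \<open>Normalised products nest to the right, so idempotence must also apply when a
    further factor follows.\<close>
  have *: "e * (e * z) = e * z" if "e \<in> A" for e z
    using assms(1)[OF that] by (simp add: mult.assoc[symmetric])
  show ?thesis
    unfolding distrib_lattice_on_def
    by (intro conjI ballI) (simp_all add: assms * algebra_simps)
qed

theorem mainTheorem2:
  shows "(\<forall>X :: 'a::{finite, distrib_strong_semilattice_sup} set. X \<noteq> {} \<longrightarrow>
            val_map nu (big_meet X) = val_of (gen_filter X))
    \<and> bij_betw (val_map nu) (envelope :: 'a valuation_ring set)
        (range (val_of :: 'a irr_filter \<Rightarrow> 'a irr_filter valuation_ring))
    \<and> distrib_lattice_on (envelope :: 'a valuation_ring set) (\<lambda>e f. e * f) (\<lambda>e f. e + f - e * f)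
    \<and> lattice_isomorphic_on
        (envelope :: 'a valuation_ring set) (\<lambda>e f. e * f) (\<lambda>e f. e + f - e * f)
        (UNIV :: 'a irr_filter set) sup inf"
proof (intro conjI)
  let ?E = "envelope :: 'a valuation_ring set"
  let ?h = "val_map nu :: 'a valuation_ring \<Rightarrow> 'a irr_filter valuation_ring"
  show "\<forall>X :: 'a set. X \<noteq> {} \<longrightarrow> ?h (big_meet X) = val_of (gen_filter X)"
    by (simp add: big_meet_eq_incl_excl val_map_nu_incl_excl)
  show bij: "bij_betw ?h ?E (range val_of)"
    by (rule bij_betw_val_map_nu)
  show "distrib_lattice_on ?E (\<lambda>e f. e * f) (\<lambda>e f. e + f - e * f)"
    by (intro distrib_lattice_on_idempotents envelope_idem envelope_mult envelope_meet)
  \<comment> \<open>Injectivity makes \<open>inv val_of\<close> a left inverse, so this sends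
    \<open>e\<close> to the filter whose class is \<open>?h e\<close>.\<close>
  define \<phi> where "\<phi> = inv (val_of :: 'a irr_filter \<Rightarrow> _) \<circ> ?h"
  have \<phi>: "\<phi> e = F" if "?h e = val_of F" for e F
    by (simp add: \<phi>_def that inj_val_of_irr_filter)
  have h: "rng_hom ?h"
    by (rule rng_hom_val_map[OF strong_hom_nu])
  then have h_add: "?h (u + v) = ?h u + ?h v" and h_mult: "?h (u * v) = ?h u * ?h v" for u v
    by (simp_all add: rng_hom_def)
  have val_of_\<phi>: "?h e = val_of (\<phi> e)" if "e \<in> ?E" for e
  proof -
    have "?h e \<in> range val_of" using bij that by (auto simp: bij_betw_def)
    then show ?thesis using \<phi> by auto
  qed
  have "bij_betw \<phi> ?E UNIV"
    unfolding \<phi>_def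
    by (rule bij_betw_trans[OF bij])
      (rule bij_betw_inv_into[OF inj_on_imp_bij_betw[OF inj_val_of_irr_filter]])
  moreover have "\<phi> (e * f) = sup (\<phi> e) (\<phi> f)" "\<phi> (e + f - e * f) = inf (\<phi> e) (\<phi> f)"
    if "e \<in> ?E" "f \<in> ?E" for e f
    using that
    \<comment> \<open>It suffices to compare classes: \<open>val_of\<close> turns \<open>sup\<close>
      into the product and \<open>inf\<close> into \<open>e + f - e * f\<close>.\<close>
    by (auto intro!: \<phi> simp: h_add h_mult rng_hom_diff[OF h] val_of_\<phi> val_of_mult val_of_inf)
  ultimately show "lattice_isomorphic_on ?E (\<lambda>e f. e * f) (\<lambda>e f. e + f - e * f)
      (UNIV :: 'a irr_filter set) sup inf"
    unfolding lattice_isomorphic_on_def by blast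
qed

end
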